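(* Let $A,B\in\mathbb{R}^{n\times n}$ be nonzero symmetric matrices with $B$ positive semidefinite, and let $\sigma\in\mathbb{R}$ be such that $A-\sigma B$ is nonsingular. Let $\breve A=\mathrm{fl}(A-\sigma B)$ be computed element-wise in floating point arithmetic with unit roundoff $u$, so that $\breve A=\breve A^{T}$. Let $C_a\in\mathbb{R}^{n\times n}$, $D_a$ diagonal with diagonal entries $\pm1$, $C_b\in\mathbb{R}^{n\times r}$ ($r\le n$), $X\in\mathbb{R}^{n\times r}$, $W\in\mathbb{R}^{r\times r}$, $U\in\mathbb{R}^{r\times r}$ and diagonal $\Theta\in\mathbb{R}^{r\times r}$ be (computed) matrices satisfying $$\|\breve A-C_aD_aC_a^{T}\|_2\le u\,a_n\|\breve A\|_2,\qquad \|C_a\|_2\le b_n\|\breve A\|_2^{1/2},\qquad \|B-C_bC_b^{T}\|_2\le u\,c_n\|B\|_2,$$ $$\|C_aX-C_b\|_2\le u\,d_n\|C_a\|_2\|X\|_2,\qquad \|W-X^{T}D_aX\|_2\le u\,e_n\|X\|_2^2,\qquad W=W^{T},$$ $$\|W-\tilde U\Theta\tilde U^{T}\|_2\le u\,f_n\|W\|_2,\qquad \|\tilde U-U\|_2\le u\,g_n,$$ where $\tilde U\in\mathbb{R}^{r\times r}$ is orthogonal and $a_n,b_n,c_n,d_n,e_n,f_n,g_n$ are positive functions of $n$. Let $$\eta=\frac{\|A-\sigma B\|_2^{1/2}}{\|B\|_2^{1/2}},\qquad \sigma_0=\sigma\frac{\|B\|_2}{\|A\|_2}.$$ Then there exist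 a matrix $F_1\in\mathbb{R}^{n\times r}$ and symmetric matrices $\breve E,E,F\in\mathbb{R}^{n\times n}$ and $G\in\mathbb{R}^{r\times r}$ satisfying $$(C_b+F_1)(C_b+F_1)^{T}=B+F,$$ $$(A+E)-\sigma(B+F)=A-\sigma B+\breve E=C_aD_aC_a^{T},$$ $$(C_b+F_1)^{T}\bigl(A+E-\sigma(B+F)\bigr)^{-1}(C_b+F_1)=\tilde U(\Theta+G)\tilde U^{T},$$ with $$\|F_1\|_2\le u\,b_nd_n\,\eta\|X\|_2\|C_b\|_2+O(u^2),$$ $$\|F\|_2\le u\,(c_n+2b_nd_n\,\eta\|X\|_2)\|B\|_2+O(u^2),$$ $$\|\breve E\|_2\le nu\,\|\sigma B\|_2+u\,(n+a_n)\|A-\sigma B\|_2+O(u^2),$$ $$\|E\|_2\le u\bigl(n(1+2|\sigma_0|)+(1+|\sigma_0|)a_n+|\sigma_0|c_n+2|\sigma_0|b_nd_n\,\eta\|X\|_2\bigr)\|A\|_2+O(u^2),$$ $$\|G\|_2\le u\,(e_n+f_n)\|X\|_2^2+O(u^2).$$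
   Context: Floating point model: each elementary operation satisfies $\mathrm{fl}(x\circ y)=(x\circ y)(1+\delta)$ with $|\delta|\le u$. Thus $\breve A=\mathrm{fl}(A-\sigma B)$ has entries $\breve a_{ij}=\bigl(a_{ij}-\sigma b_{ij}(1+\delta_{ij})\bigr)(1+\delta'_{ij})$ with $|\delta_{ij}|,|\delta'_{ij}|\le u$ (symmetric in $i,j$, since $A$ and $B$ are symmetric and the same operations are applied). The matrices $C_a,D_a,C_b,X,W,U,\Theta$ are the quantities computed by a spectral transformation algorithm for $Av=\lambda Bv$: factor $A-\sigma B= C_aD_aC_a^T$ and $B= C_bC_b^T$, solve $C_aX=C_b$, form $W=X^TD_aX$, and compute an eigenvalue decomposition $W=U\Theta U^T$. The only properties of these computed quantities that are used are the displayed error bounds. Convention on $O(u^2)$ (first-order analysis as $u\to0$): there are constants $K,u_0>0$ depending only on $n,A,B,\sigma$ and $a_n,\dots,g_n$ such that, for every $0<u\le u_0$ and all matrices satisfying the hypotheses, the assertions hold with each $O(u^2)$ replaced by a quantity of absolute value at most $Ku^2$. *)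

theory Defs
  imports Complex_Main "Jordan_Normal_Form.Matrix"
begin

text \<open>Matrices are those of \<^theory>\<open>Jordan_Normal_Form.Matrix\<close>, whose dimensions are natural
  numbers rather than types. This lets the number of columns \<open>r \<le> n\<close> be quantified after the
  constants hidden in the \<open>O(u\<^sup>2)\<close> terms.\<close>

definition vec_norm2 :: "real vec \<Rightarrow> real" where
  "vec_norm2 v = sqrt (v \<bullet> v)"

text \<open>The operator 2-norm. The supremum is over the closed unit ball and not the unit sphere, so
  that it ranges over a nonempty set (and yields 0) also for a matrix without columns.\<close>

definition norm2 :: "real mat \<Rightarrow> real" where
  "norm2 M = (SUP v\<in>{v \<in> carrier_vec (dim_col M). vec_norm2 v \<le> 1}. vec_norm2 (M *\<^sub>v v))"

definition positive_semidefinite :: "real mat \<Rightarrow> bool" where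
  "positive_semidefinite M \<longleftrightarrow> (\<forall>v \<in> carrier_vec (dim_col M). 0 \<le> v \<bullet> (M *\<^sub>v v))"

text \<open>\<open>is_fl_shift u A B \<sigma> S\<close>: \<open>S\<close> is a possible result of computing \<open>A - \<sigma>B\<close> entry by entry
  with unit roundoff \<open>u\<close>. Here \<open>\<delta>\<close> is the relative error of the product \<open>\<sigma> b\<^sub>i\<^sub>j\<close> and \<open>\<delta>'\<close> that of
  the subtraction. Both are symmetric because \<open>A\<close> and \<open>B\<close> are, and the same
  operations are applied to the entries \<open>(i,j)\<close> and \<open>(j,i)\<close>; hence \<open>S\<close> is symmetric too.\<close>

definition is_fl_shift :: "real \<Rightarrow> real mat \<Rightarrow> real mat \<Rightarrow> real \<Rightarrow> real mat \<Rightarrow> bool" where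
  "is_fl_shift u A B \<sigma> S \<longleftrightarrow>
     S \<in> carrier_mat (dim_row A) (dim_col A) \<and>
     (\<exists>\<delta> \<delta>' :: nat \<Rightarrow> nat \<Rightarrow> real. \<forall>i < dim_row A. \<forall>j < dim_col A.
        \<bar>\<delta> i j\<bar> \<le> u \<and> \<bar>\<delta>' i j\<bar> \<le> u \<and> \<delta> i j = \<delta> j i \<and> \<delta>' i j = \<delta>' j i \<and>
        S $$ (i,j) = (A $$ (i,j) - \<sigma> * B $$ (i,j) * (1 + \<delta> i j)) * (1 + \<delta>' i j))"

end

theory Submission
  imports Defs "HOL-Analysis.L2_Norm" "Jordan_Normal_Form.Determinant"
begin

text \<open>Take \<open>F\<^sub>1 = C\<^sub>a X - C\<^sub>b\<close>, so that \<open>C\<^sub>b + F\<^sub>1 = C\<^sub>a X\<close>; the other perturbations are then forced.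
  With \<open>T = C\<^sub>a D\<^sub>a C\<^sub>a\<^sup>T\<close> we have \<open>C\<^sub>a\<^sup>T T\<inverse> C\<^sub>a = D\<^sub>a\<close>, hence
  \<open>(C\<^sub>a X)\<^sup>T T\<inverse> (C\<^sub>a X) = X\<^sup>T D\<^sub>a X\<close>, which is close to \<open>W\<close>. The constants in \<open>O(u\<^sup>2)\<close> are uniform
  because \<open>X = D\<^sub>a C\<^sub>a\<^sup>T T\<inverse> (C\<^sub>a X)\<close> is bounded a priori: for small \<open>u\<close>, \<open>T\<close> is a small perturbation
  of the nonsingular matrix \<open>A - \<sigma>B\<close>, so \<open>T\<inverse>\<close> exists and is bounded, while \<open>C\<^sub>a X\<close> is close to \<open>C\<^sub>b\<close>,
  whose norm is about \<open>\<parallel>B\<parallel>\<^sup>1\<^sup>/\<^sup>2\<close>.\<close>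

subsection \<open>The Euclidean norm of vectors\<close>

lemma vec_norm2_L2_set: "vec_norm2 v = L2_set (($) v) {0..<dim_vec v}"
  by (simp add: vec_norm2_def L2_set_def scalar_prod_def power2_eq_square)

lemma vec_norm2_nonneg [simp]: "0 \<le> vec_norm2 v"
  by (simp add: vec_norm2_L2_set L2_set_nonneg)

lemma vec_norm2_square: "(vec_norm2 v)\<^sup>2 = v \<bullet> v"
  by (simp add: vec_norm2_def scalar_prod_def sum_nonneg)

lemma vec_norm2_zero [simp]: "vec_norm2 (0\<^sub>v n) = 0"
  by (simp add: vec_norm2_def)

lemma vec_norm2_eq_0_iff:
  assumes "v \<in> carrier_vec n"
  shows "vec_norm2 v = 0 \<longleftrightarrow> v = 0\<^sub>v n"
  using assms by (auto simp: vec_norm2_L2_set L2_set_eq_0_iff)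

lemma vec_norm2_smult: "vec_norm2 (c \<cdot>\<^sub>v v) = \<bar>c\<bar> * vec_norm2 v"
  by (simp add: vec_norm2_def real_sqrt_mult flip: mult.assoc)

lemma vec_norm2_triangle:
  assumes "v \<in> carrier_vec n" "w \<in> carrier_vec n"
  shows "vec_norm2 (v + w) \<le> vec_norm2 v + vec_norm2 w"
proof -
  have "vec_norm2 (v + w) = L2_set (\<lambda>i. v $ i + w $ i) {0..<n}"
    using assms unfolding vec_norm2_L2_set by (intro L2_set_cong) auto
  also have "\<dots> \<le> L2_set (($) v) {0..<n} + L2_set (($) w) {0..<n}"
    by (rule L2_set_triangle_ineq)
  finally show ?thesis
    using assms by (simp add: vec_norm2_L2_set)
qed

lemma scalar_prod_le_vec_norm2:
  assumes "v \<in> carrier_vec n" "w \<in> carrier_vec n"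
  shows "v \<bullet> w \<le> vec_norm2 v * vec_norm2 w"
proof -
  have "v \<bullet> w \<le> (\<Sum>i\<in>{0..<n}. \<bar>v $ i\<bar> * \<bar>w $ i\<bar>)"
    using assms unfolding scalar_prod_def
    by (auto intro!: sum_mono simp: abs_mult[symmetric])
  also have "\<dots> \<le> L2_set (($) v) {0..<n} * L2_set (($) w) {0..<n}"
    by (rule L2_set_mult_ineq)
  finally show ?thesis
    using assms by (simp add: vec_norm2_L2_set)
qed

lemma vec_norm2_unit:
  assumes "i < n"
  shows "vec_norm2 (unit_vec n i) = 1"
  using assms by (simp add: vec_norm2_def)

lemma abs_index_le_vec_norm2:
  assumes "i < dim_vec v"
  shows "\<bar>v $ i\<bar> \<le> vec_norm2 v"
  using assms member_le_L2_set[of "{0..<dim_vec v}" i "\<lambda>i. \<bar>v $ i\<bar>"]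
  by (simp add: vec_norm2_L2_set L2_set_def)

subsection \<open>The operator norm\<close>

text \<open>Cauchy-Schwarz in each row costs \<open>sqrt nc\<close>, and collecting the rows costs
  \<open>sqrt nr\<close>. The bound serves twice: it makes the supremum in \<open>norm2\<close>
  finite, and for square matrices it produces the factor \<open>n\<close> in the rounding error
  estimate.\<close>

lemma vec_norm2_mult_entry_bound:
  assumes M: "M \<in> carrier_mat nr nc" and v: "v \<in> carrier_vec nc"
    and bound: "\<And>i j. i < nr \<Longrightarrow> j < nc \<Longrightarrow> \<bar>M $$ (i,j)\<bar> \<le> c" and c: "0 \<le> c"
  shows "vec_norm2 (M *\<^sub>v v) \<le> sqrt (real nr) * sqrt (real nc) * c * vec_norm2 v"
proof -
  have entry: "\<bar>(M *\<^sub>v v) $ i\<bar> \<le> sqrt (real nc) * c * vec_norm2 v" if i: "i < nr" for i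
  proof -
    have "\<bar>(M *\<^sub>v v) $ i\<bar> = \<bar>\<Sum>j\<in>{0..<nc}. M $$ (i,j) * v $ j\<bar>"
      using M v i by (simp add: scalar_prod_def)
    also have "\<dots> \<le> (\<Sum>j\<in>{0..<nc}. \<bar>c\<bar> * \<bar>v $ j\<bar>)"
      using bound[OF i] c
      by (intro order_trans[OF sum_abs] sum_mono) (auto simp: abs_mult intro!: mult_right_mono)
    also have "\<dots> \<le> L2_set (\<lambda>_. c) {0..<nc} * L2_set (($) v) {0..<nc}"
      by (rule L2_set_mult_ineq)
    also have "\<dots> = sqrt (real nc) * c * vec_norm2 v"
      using v c by (simp add: vec_norm2_L2_set L2_set_constant)
    finally show ?thesis .
  qed
  have "vec_norm2 (M *\<^sub>v v) = L2_set (\<lambda>i. \<bar>(M *\<^sub>v v) $ i\<bar>) {0..<nr}"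
    using M by (simp add: vec_norm2_L2_set L2_set_def)
  also have "\<dots> \<le> L2_set (\<lambda>_. sqrt (real nc) * c * vec_norm2 v) {0..<nr}"
    by (rule L2_set_mono) (simp_all add: entry)
  also have "\<dots> = sqrt (real nr) * sqrt (real nc) * c * vec_norm2 v"
    using c by (simp add: L2_set_constant)
  finally show ?thesis .
qed

text \<open>A real supremum is informative only for a set bounded above, so every later use of
  \<open>norm2\<close> as an upper bound rests on this. The sum of the absolute values of all
  entries serves as a common entry bound.\<close>

lemma bdd_above_norm2:
  "bdd_above ((\<lambda>v. vec_norm2 (M *\<^sub>v v)) ` {v \<in> carrier_vec (dim_col M). vec_norm2 v \<le> 1})"
proof -
  define c where "c = (\<Sum>i<dim_row M. \<Sum>j<dim_col M. \<bar>M $$ (i,j)\<bar>)"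
  have c0: "0 \<le> c"
    by (simp add: c_def sum_nonneg)
  have c: "\<bar>M $$ (i,j)\<bar> \<le> c" if "i < dim_row M" "j < dim_col M" for i j
  proof -
    have "\<bar>M $$ (i,j)\<bar> \<le> (\<Sum>j<dim_col M. \<bar>M $$ (i,j)\<bar>)"
      using that by (intro member_le_sum) auto
    also have "\<dots> \<le> c"
      unfolding c_def using that
      by (intro member_le_sum[where f = "\<lambda>i. \<Sum>j<dim_col M. \<bar>M $$ (i,j)\<bar>"]) (auto intro: sum_nonneg)
    finally show ?thesis .
  qed
  define k where "k = sqrt (real (dim_row M)) * sqrt (real (dim_col M)) * c"
  have "vec_norm2 (M *\<^sub>v v) \<le> k" if v: "v \<in> carrier_vec (dim_col M)" "vec_norm2 v \<le> 1" for v
  proof -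
    have "vec_norm2 (M *\<^sub>v v) \<le> k * vec_norm2 v"
      unfolding k_def by (rule vec_norm2_mult_entry_bound) (use v c c0 in auto)
    also have "\<dots> \<le> k * 1"
      using v c0 by (intro mult_left_mono) (auto simp: k_def)
    finally show ?thesis by simp
  qed
  then show ?thesis
    by (intro bdd_aboveI[of _ k]) auto
qed

lemma norm2_nonneg [simp]: "0 \<le> norm2 M"
  unfolding norm2_def
  by (rule cSUP_upper2[OF bdd_above_norm2, of "0\<^sub>v (dim_col M)"]) auto

text \<open>Homogeneity reduces the claim to a unit vector, where it is the definition of the
  supremum. The zero vector cannot be normalised and is treated separately.\<close>

lemma vec_norm2_mult_le:
  assumes M: "M \<in> carrier_mat nr nc" and v: "v \<in> carrier_vec nc"
  shows "vec_norm2 (M *\<^sub>v v) \<le> norm2 M * vec_norm2 v"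
proof (cases "vec_norm2 v = 0")
  case True
  then have "v = 0\<^sub>v nc"
    using v vec_norm2_eq_0_iff by blast
  then have "M *\<^sub>v v = 0\<^sub>v nr"
    using M by auto
  then show ?thesis
    using True by simp
next
  case False
  define t where "t = vec_norm2 v"
  have t: "t > 0"
    using False by (simp add: t_def less_le)
  define w where "w = (1 / t) \<cdot>\<^sub>v v"
  have w: "w \<in> carrier_vec nc" "vec_norm2 w = 1"
    using v t by (auto simp: w_def vec_norm2_smult t_def)
  have "v = t \<cdot>\<^sub>v w"
    using t by (simp add: w_def smult_smult_assoc)
  then have "vec_norm2 (M *\<^sub>v v) = t * vec_norm2 (M *\<^sub>v w)"
    using M w t by (simp add: mult_mat_vec vec_norm2_smult)
  also have "\<dots> \<le> t * norm2 M"
    unfolding norm2_def using t w M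
    by (intro mult_left_mono cSUP_upper[OF _ bdd_above_norm2]) auto
  finally show ?thesis
    by (simp add: t_def mult.commute)
qed

lemma norm2_le:
  assumes M: "M \<in> carrier_mat nr nc" and c: "0 \<le> c"
    and bound: "\<And>v. v \<in> carrier_vec nc \<Longrightarrow> vec_norm2 (M *\<^sub>v v) \<le> c * vec_norm2 v"
  shows "norm2 M \<le> c"
  unfolding norm2_def
proof (rule cSUP_least)
  show "{v \<in> carrier_vec (dim_col M). vec_norm2 v \<le> 1} \<noteq> {}"
    by (auto intro: exI[of _ "0\<^sub>v (dim_col M)"])
  fix v assume "v \<in> {v \<in> carrier_vec (dim_col M). vec_norm2 v \<le> 1}"
  then have v: "v \<in> carrier_vec nc" "vec_norm2 v \<le> 1"
    using M by auto
  then have "vec_norm2 (M *\<^sub>v v) \<le> c * vec_norm2 v"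
    by (intro bound)
  also have "\<dots> \<le> c * 1"
    using v c by (intro mult_left_mono) auto
  finally show "vec_norm2 (M *\<^sub>v v) \<le> c" by simp
qed

lemma norm2_entry_bound:
  assumes "M \<in> carrier_mat nr nc" "0 \<le> c"
    and "\<And>i j. i < nr \<Longrightarrow> j < nc \<Longrightarrow> \<bar>M $$ (i,j)\<bar> \<le> c"
  shows "norm2 M \<le> sqrt (real nr) * sqrt (real nc) * c"
  by (rule norm2_le[OF assms(1)]) (use assms in \<open>auto intro: vec_norm2_mult_entry_bound\<close>)

lemma abs_entry_le_norm2:
  assumes M: "M \<in> carrier_mat nr nc" and ij: "i < nr" "j < nc"
  shows "\<bar>M $$ (i,j)\<bar> \<le> norm2 M"
proof -
  have "M $$ (i,j) = (M *\<^sub>v unit_vec nc j) $ i"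
    using M ij by simp
  then have "\<bar>M $$ (i,j)\<bar> \<le> vec_norm2 (M *\<^sub>v unit_vec nc j)"
    using M ij abs_index_le_vec_norm2[of i "M *\<^sub>v unit_vec nc j"] by simp
  also have "\<dots> \<le> norm2 M * 1"
    using vec_norm2_mult_le[OF M unit_vec_carrier, of j] ij by (simp add: vec_norm2_unit)
  finally show ?thesis by simp
qed

lemma norm2_pos:
  assumes M: "M \<in> carrier_mat nr nc" and nz: "M \<noteq> 0\<^sub>m nr nc"
  shows "0 < norm2 M"
proof -
  obtain i j where ij: "i < nr" "j < nc" "M $$ (i,j) \<noteq> 0"
    using M nz by (metis carrier_matD eq_matI index_zero_mat)
  then show ?thesis
    using abs_entry_le_norm2[OF M ij(1,2)] by linarith
qed

lemma norm2_add_le: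
  assumes M: "M \<in> carrier_mat nr nc" and N: "N \<in> carrier_mat nr nc"
  shows "norm2 (M + N) \<le> norm2 M + norm2 N"
proof (rule norm2_le)
  show "M + N \<in> carrier_mat nr nc" using N by auto
  show "0 \<le> norm2 M + norm2 N" by simp
  fix v :: "real vec" assume v: "v \<in> carrier_vec nc"
  have "vec_norm2 ((M + N) *\<^sub>v v) \<le> vec_norm2 (M *\<^sub>v v) + vec_norm2 (N *\<^sub>v v)"
    using M N v by (simp add: add_mult_distrib_mat_vec[OF M N v] vec_norm2_triangle[of _ nr])
  also have "\<dots> \<le> norm2 M * vec_norm2 v + norm2 N * vec_norm2 v"
    using M N v by (intro add_mono vec_norm2_mult_le)
  finally show "vec_norm2 ((M + N) *\<^sub>v v) \<le> (norm2 M + norm2 N) * vec_norm2 v"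
    by (simp add: algebra_simps)
qed

lemma norm2_smult_le:
  assumes M: "M \<in> carrier_mat nr nc"
  shows "norm2 (c \<cdot>\<^sub>m M) \<le> \<bar>c\<bar> * norm2 M"
proof (rule norm2_le)
  show "c \<cdot>\<^sub>m M \<in> carrier_mat nr nc" using M by simp
  fix v :: "real vec" assume v: "v \<in> carrier_vec nc"
  have "(c \<cdot>\<^sub>m M) *\<^sub>v v = c \<cdot>\<^sub>v (M *\<^sub>v v)"
    using M v by (intro eq_vecI) (auto simp: scalar_prod_def sum_distrib_left mult.assoc)
  then show "vec_norm2 ((c \<cdot>\<^sub>m M) *\<^sub>v v) \<le> \<bar>c\<bar> * norm2 M * vec_norm2 v"
    using vec_norm2_mult_le[OF M v] by (simp add: vec_norm2_smult mult_left_mono mult.assoc)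
qed simp

lemma norm2_uminus_le:
  assumes M: "M \<in> carrier_mat nr nc"
  shows "norm2 (- M) \<le> norm2 M"
proof -
  have "- M = (-1) \<cdot>\<^sub>m M"
    using M by (intro eq_matI) auto
  then show ?thesis
    using norm2_smult_le[OF M, of "-1"] by simp
qed

lemma norm2_diff_le:
  assumes M: "M \<in> carrier_mat nr nc" and N: "N \<in> carrier_mat nr nc"
  shows "norm2 (M - N) \<le> norm2 M + norm2 N"
proof -
  have "M - N = M + - N"
    using M N by (intro eq_matI) auto
  then show ?thesis
    using norm2_add_le[OF M, of "- N"] norm2_uminus_le[OF N] N by simp
qed

lemma norm2_diff_commute_le:
  assumes M: "M \<in> carrier_mat nr nc" and N: "N \<in> carrier_mat nr nc"
  shows "norm2 (M - N) \<le> norm2 (N - M)"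
proof -
  have "M - N = - (N - M)"
    using M N by (intro eq_matI) auto
  then show ?thesis
    using norm2_uminus_le[OF minus_carrier_mat[OF M], of N] M by simp
qed

lemma norm2_triangle_diff:
  assumes "L \<in> carrier_mat nr nc" "M \<in> carrier_mat nr nc" "N \<in> carrier_mat nr nc"
  shows "norm2 (L - N) \<le> norm2 (L - M) + norm2 (M - N)"
proof -
  have "L - N = (L - M) + (M - N)"
    using assms by (intro eq_matI) auto
  then show ?thesis
    using norm2_add_le[of "L - M" nr nc "M - N"] assms by (simp add: minus_carrier_mat)
qed

lemma norm2_le_add_diff:
  assumes M: "M \<in> carrier_mat nr nc" and N: "N \<in> carrier_mat nr nc"
  shows "norm2 M \<le> norm2 N + norm2 (M - N)"
proof -
  have "M = N + (M - N)"
    using assms by (intro eq_matI) auto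
  then show ?thesis
    using norm2_add_le[OF N minus_carrier_mat[OF N, of M]] by simp
qed

lemma norm2_mult_le:
  assumes M: "M \<in> carrier_mat nr k" and N: "N \<in> carrier_mat k nc"
  shows "norm2 (M * N) \<le> norm2 M * norm2 N"
proof (rule norm2_le)
  show "M * N \<in> carrier_mat nr nc" using M N by simp
  fix v :: "real vec" assume v: "v \<in> carrier_vec nc"
  have "vec_norm2 ((M * N) *\<^sub>v v) \<le> norm2 M * vec_norm2 (N *\<^sub>v v)"
    using M N v by (simp add: assoc_mult_mat_vec[OF M N v] vec_norm2_mult_le)
  also have "\<dots> \<le> norm2 M * (norm2 N * vec_norm2 v)"
    using N v by (intro mult_left_mono vec_norm2_mult_le) auto
  finally show "vec_norm2 ((M * N) *\<^sub>v v) \<le> norm2 M * norm2 N * vec_norm2 v"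
    by (simp add: mult.assoc)
qed simp

text \<open>Moving \<open>M\<close> across the inner product is the source of both the invariance of
  the norm under transposition and the identity for the norm of
  \<open>M * M\<^sup>T\<close>.\<close>

lemma vec_norm2_square_transpose_mult:
  assumes M: "M \<in> carrier_mat nr nc" and w: "w \<in> carrier_vec nr"
  shows "(vec_norm2 (M\<^sup>T *\<^sub>v w))\<^sup>2 = w \<bullet> (M *\<^sub>v (M\<^sup>T *\<^sub>v w))"
proof -
  have "(vec_norm2 (M\<^sup>T *\<^sub>v w))\<^sup>2 = (M\<^sup>T *\<^sub>v w) \<bullet> (M\<^sup>T *\<^sub>v w)"
    by (rule vec_norm2_square)
  also have "\<dots> = w \<bullet> (M *\<^sub>v (M\<^sup>T *\<^sub>v w))"
    by (rule transpose_vec_mult_scalar) (use M w in auto)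
  finally show ?thesis .
qed

text \<open>With \<open>y = M\<^sup>T *\<^sub>v w\<close>, the square of the norm of
  \<open>y\<close> is the inner product of \<open>w\<close> with \<open>M *\<^sub>v y\<close>.
  Cauchy-Schwarz bounds this by a multiple of the norm of \<open>y\<close>, and one factor
  cancels.\<close>

lemma norm2_transpose_le:
  assumes M: "M \<in> carrier_mat nr nc"
  shows "norm2 M\<^sup>T \<le> norm2 M"
proof (rule norm2_le)
  show "M\<^sup>T \<in> carrier_mat nc nr" using M by simp
  fix w :: "real vec" assume w: "w \<in> carrier_vec nr"
  define y where "y = M\<^sup>T *\<^sub>v w"
  have y: "y \<in> carrier_vec nc" using M w by (simp add: y_def)
  have "vec_norm2 y * vec_norm2 y = w \<bullet> (M *\<^sub>v y)"
    using vec_norm2_square_transpose_mult[OF M w] by (simp add: y_def power2_eq_square)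
  also have "\<dots> \<le> vec_norm2 w * vec_norm2 (M *\<^sub>v y)"
    using M w y by (intro scalar_prod_le_vec_norm2) auto
  also have "\<dots> \<le> vec_norm2 w * (norm2 M * vec_norm2 y)"
    using M y by (intro mult_left_mono vec_norm2_mult_le) auto
  finally have "vec_norm2 y * vec_norm2 y \<le> (norm2 M * vec_norm2 w) * vec_norm2 y"
    by (simp add: algebra_simps)
  then show "vec_norm2 (M\<^sup>T *\<^sub>v w) \<le> norm2 M * vec_norm2 w"
    unfolding y_def[symmetric] by (cases "vec_norm2 y = 0") (auto simp: less_le)
qed simp

lemma norm2_transpose: "norm2 M\<^sup>T = norm2 M"
  using norm2_transpose_le[of M "dim_row M" "dim_col M"]
    norm2_transpose_le[of "M\<^sup>T" "dim_col M" "dim_row M"]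
  by simp

lemma norm2_square_le_mult_transpose:
  assumes M: "M \<in> carrier_mat nr nc"
  shows "(norm2 M)\<^sup>2 \<le> norm2 (M * M\<^sup>T)"
proof -
  have "norm2 M\<^sup>T \<le> sqrt (norm2 (M * M\<^sup>T))"
  proof (rule norm2_le)
    show "M\<^sup>T \<in> carrier_mat nc nr" using M by simp
    fix w :: "real vec" assume w: "w \<in> carrier_vec nr"
    have MMt: "M * M\<^sup>T \<in> carrier_mat nr nr" using M by simp
    have "(vec_norm2 (M\<^sup>T *\<^sub>v w))\<^sup>2 = w \<bullet> ((M * M\<^sup>T) *\<^sub>v w)"
      using M w vec_norm2_square_transpose_mult[OF M w]
      by (simp add: assoc_mult_mat_vec[of M nr nc "M\<^sup>T" nr])
    also have "\<dots> \<le> vec_norm2 w * vec_norm2 ((M * M\<^sup>T) *\<^sub>v w)"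
      using MMt w by (intro scalar_prod_le_vec_norm2) auto
    also have "\<dots> \<le> vec_norm2 w * (norm2 (M * M\<^sup>T) * vec_norm2 w)"
      using MMt w by (intro mult_left_mono vec_norm2_mult_le) auto
    also have "\<dots> = (sqrt (norm2 (M * M\<^sup>T)) * vec_norm2 w)\<^sup>2"
      by (simp add: power2_eq_square algebra_simps)
    finally show "vec_norm2 (M\<^sup>T *\<^sub>v w) \<le> sqrt (norm2 (M * M\<^sup>T)) * vec_norm2 w"
      by (rule power2_le_imp_le) simp
  qed simp
  then show ?thesis
    using power_mono[of "norm2 M" "sqrt (norm2 (M * M\<^sup>T))" 2] by (simp add: norm2_transpose)
qed

text \<open>This C*-identity is what allows the norm of \<open>C\<^sub>b\<close> to be compared with
  the square root of the norm of \<open>B\<close>, both from above and from below.\<close>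

lemma norm2_mult_transpose: "norm2 (M * M\<^sup>T) = (norm2 M)\<^sup>2"
proof (rule antisym)
  have M: "M \<in> carrier_mat (dim_row M) (dim_col M)" by simp
  show "(norm2 M)\<^sup>2 \<le> norm2 (M * M\<^sup>T)"
    by (rule norm2_square_le_mult_transpose[OF M])
  show "norm2 (M * M\<^sup>T) \<le> (norm2 M)\<^sup>2"
    using norm2_mult_le[OF M, of "M\<^sup>T" "dim_row M"] by (simp add: norm2_transpose power2_eq_square)
qed

text \<open>The C*-identity for the transpose reduces this to the norm of the identity matrix. It is
  an inequality because the norm is 0 when there are no columns, as may happen for
  \<open>r = 0\<close>.\<close>

lemma norm2_isometry_le_1:
  assumes Q: "Q \<in> carrier_mat nr nc" and orth: "Q\<^sup>T * Q = 1\<^sub>m nc"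
  shows "norm2 Q \<le> 1"
proof -
  have "(norm2 Q)\<^sup>2 = norm2 (1\<^sub>m nc :: real mat)"
    using norm2_mult_transpose[of "Q\<^sup>T"] orth by (simp add: norm2_transpose)
  also have "\<dots> \<le> 1"
    by (rule norm2_le[of _ nc nc]) auto
  finally show ?thesis
    by (simp add: abs_square_le_1)
qed

lemma norm2_congruence_le:
  assumes "M \<in> carrier_mat n n" and "X \<in> carrier_mat n r"
  shows "norm2 (X\<^sup>T * M * X) \<le> norm2 M * (norm2 X)\<^sup>2"
proof -
  have "norm2 (X\<^sup>T * M * X) \<le> norm2 (X\<^sup>T * M) * norm2 X"
    using assms by (intro norm2_mult_le[of _ r n _ r]) auto
  also have "\<dots> \<le> (norm2 X\<^sup>T * norm2 M) * norm2 X"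
    using assms by (intro mult_right_mono norm2_mult_le[of _ r n _ n]) auto
  finally show ?thesis
    by (simp add: norm2_transpose power2_eq_square mult_ac)
qed

subsection \<open>Matrix perturbation lemmas\<close>

lemma transpose_smult: "(c \<cdot>\<^sub>m M)\<^sup>T = c \<cdot>\<^sub>m M\<^sup>T"
  by (intro eq_matI) auto

lemma transpose_diagonal:
  assumes "D \<in> carrier_mat n n" "diagonal_mat D"
  shows "D\<^sup>T = D"
proof (rule eq_matI)
  fix i j assume "i < dim_row D" "j < dim_col D"
  then show "D\<^sup>T $$ (i,j) = D $$ (i,j)"
    using assms by (cases "i = j") (auto simp: diagonal_mat_def)
qed (use assms in auto)

lemma signature_mat_square:
  fixes D :: "real mat"
  assumes D: "D \<in> carrier_mat n n" "diagonal_mat D"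
    and sgn: "\<forall>i<n. D $$ (i,i) = 1 \<or> D $$ (i,i) = -1"
  shows "D * D = 1\<^sub>m n"
proof (rule eq_matI)
  fix i j assume ij: "i < dim_row (1\<^sub>m n :: real mat)" "j < dim_col (1\<^sub>m n :: real mat)"
  have "(D * D) $$ (i,j) = (\<Sum>k\<in>{0..<n}. D $$ (i,k) * D $$ (k,j))"
    using D ij by (simp add: scalar_prod_def)
  also have "\<dots> = (\<Sum>k\<in>{0..<n}. if k = i then D $$ (i,i) * D $$ (i,j) else 0)"
    using D ij by (intro sum.cong) (auto simp: diagonal_mat_def)
  also have "\<dots> = D $$ (i,i) * D $$ (i,j)"
    using ij by simp
  also have "\<dots> = 1\<^sub>m n $$ (i,j)"
  proof (cases "i = j")
    case True
    then show ?thesis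
      using sgn[rule_format, of i] ij by auto
  next
    case False
    then show ?thesis
      using D ij by (simp add: diagonal_mat_def)
  qed
  finally show "(D * D) $$ (i,j) = 1\<^sub>m n $$ (i,j)" .
qed (use D in auto)

lemma symmetric_congruence:
  fixes D :: "real mat"
  assumes D: "D \<in> carrier_mat n n" "D\<^sup>T = D" and C: "C \<in> carrier_mat r n"
  shows "(C * D * C\<^sup>T)\<^sup>T = C * D * C\<^sup>T"
proof -
  have "(C * D * C\<^sup>T)\<^sup>T = C\<^sup>T\<^sup>T * (C * D)\<^sup>T"
    using C D by (intro transpose_mult[of _ r n _ r]) auto
  also have "(C * D)\<^sup>T = D * C\<^sup>T"
    using C D transpose_mult[of C r n D n] by simp
  also have "C\<^sup>T\<^sup>T * (D * C\<^sup>T) = C * D * C\<^sup>T"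
    using C D by (simp add: assoc_mult_mat[of C r n D n "C\<^sup>T" r])
  finally show ?thesis .
qed

text \<open>Writing \<open>v\<close> as \<open>P\<close> applied to \<open>(M + H) v - H v\<close>
  bounds the norm of \<open>v\<close> by \<open>norm2 P\<close> times that of
  \<open>(M + H) v\<close>, plus half the norm of \<open>v\<close> itself. Absorbing the half shows
  at once that the kernel is trivial and that the inverse has norm at most
  \<open>2 * norm2 P\<close>; no Neumann series is involved.\<close>

lemma obtain_inverse_of_perturbation:
  assumes M: "M \<in> carrier_mat n n" and P: "P \<in> carrier_mat n n" and H: "H \<in> carrier_mat n n"
    and PM: "P * M = 1\<^sub>m n" and small: "norm2 P * norm2 H \<le> 1/2"
  obtains N where "N \<in> carrier_mat n n" "(M + H) * N = 1\<^sub>m n" "N * (M + H) = 1\<^sub>m n"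
    "norm2 N \<le> 2 * norm2 P"
proof -
  have MH: "M + H \<in> carrier_mat n n"
    using H by simp
  have expand: "vec_norm2 v \<le> 2 * norm2 P * vec_norm2 ((M + H) *\<^sub>v v)" if v: "v \<in> carrier_vec n" for v
  proof -
    have "v = P *\<^sub>v (M *\<^sub>v v)"
      using P M v PM by (simp flip: assoc_mult_mat_vec)
    moreover have "M *\<^sub>v v = (M + H) *\<^sub>v v + - (H *\<^sub>v v)"
      using M H v by (simp add: add_mult_distrib_mat_vec[OF M H v])
        (intro eq_vecI; auto)
    ultimately have "v = P *\<^sub>v ((M + H) *\<^sub>v v + - (H *\<^sub>v v))"
      by simp
    then have "vec_norm2 v \<le> norm2 P * vec_norm2 ((M + H) *\<^sub>v v + - (H *\<^sub>v v))"
      using vec_norm2_mult_le[OF P, of "(M + H) *\<^sub>v v + - (H *\<^sub>v v)"]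
        mult_mat_vec_carrier[OF MH v] mult_mat_vec_carrier[OF H v] by simp
    also have "\<dots> \<le> norm2 P * (vec_norm2 ((M + H) *\<^sub>v v) + vec_norm2 (- (H *\<^sub>v v)))"
      using mult_mat_vec_carrier[OF MH v] mult_mat_vec_carrier[OF H v]
      by (intro mult_left_mono vec_norm2_triangle[of _ n]) auto
    also have "vec_norm2 (- (H *\<^sub>v v)) = vec_norm2 (H *\<^sub>v v)"
      by (simp add: vec_norm2_L2_set L2_set_def)
    also have "norm2 P * (vec_norm2 ((M + H) *\<^sub>v v) + vec_norm2 (H *\<^sub>v v))
        \<le> norm2 P * (vec_norm2 ((M + H) *\<^sub>v v) + norm2 H * vec_norm2 v)"
      using H v by (intro mult_left_mono add_left_mono vec_norm2_mult_le) auto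
    also have "\<dots> \<le> norm2 P * vec_norm2 ((M + H) *\<^sub>v v) + 1/2 * vec_norm2 v"
      using mult_right_mono[OF small vec_norm2_nonneg[of v]] by (simp add: algebra_simps)
    finally show ?thesis by simp
  qed
  have "det (M + H) \<noteq> 0"
  proof
    assume "det (M + H) = 0"
    then obtain v where v: "v \<in> carrier_vec n" "v \<noteq> 0\<^sub>v n" "(M + H) *\<^sub>v v = 0\<^sub>v n"
      using det_0_iff_vec_prod_zero_field[OF MH] by blast
    with expand[OF v(1)] have "vec_norm2 v = 0"
      by (simp add: order_antisym)
    with v show False
      using vec_norm2_eq_0_iff by blast
  qed
  then obtain N where N: "N \<in> carrier_mat n n" "(M + H) * N = 1\<^sub>m n"
    using det_non_zero_imp_unit[OF MH, of "()"] by (auto simp: Units_def ring_mat_def)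
  have "norm2 N \<le> 2 * norm2 P"
  proof (rule norm2_le[OF N(1)])
    fix w :: "real vec" assume w: "w \<in> carrier_vec n"
    have "(M + H) *\<^sub>v (N *\<^sub>v w) = w"
      using N MH w by (simp flip: assoc_mult_mat_vec)
    then show "vec_norm2 (N *\<^sub>v w) \<le> 2 * norm2 P * vec_norm2 w"
      using expand[of "N *\<^sub>v w"] N w by simp
  qed simp
  then show ?thesis
    using that N mat_mult_left_right_inverse[OF MH N] by blast
qed

text \<open>The crude bound \<open>n max \<bar>h\<^sub>i\<^sub>j\<bar>\<close> on the norm of the rounding error matrix already yields the
  factor \<open>n\<close> of the theorem, since the entries of a matrix are bounded by its norm.\<close>

lemma norm2_fl_shift_error:
  assumes A: "A \<in> carrier_mat n n" and B: "B \<in> carrier_mat n n" and u: "0 \<le> u"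
    and fl: "is_fl_shift u A B \<sigma> S"
  shows "norm2 (S - (A - \<sigma> \<cdot>\<^sub>m B))
    \<le> real n * u * norm2 (A - \<sigma> \<cdot>\<^sub>m B) + real n * u * (1 + u) * norm2 (\<sigma> \<cdot>\<^sub>m B)"
proof -
  define M where "M = A - \<sigma> \<cdot>\<^sub>m B"
  have M: "M \<in> carrier_mat n n" and sB: "\<sigma> \<cdot>\<^sub>m B \<in> carrier_mat n n"
    using A B by (auto simp: M_def)
  have S: "S \<in> carrier_mat n n"
    using fl A by (auto simp: is_fl_shift_def)
  have dims: "dim_row A = n" "dim_col A = n"
    using A by auto
  obtain \<delta> \<delta>' where \<delta>: "\<And>i j. i < n \<Longrightarrow> j < n \<Longrightarrow> \<bar>\<delta> i j\<bar> \<le> u \<and> \<bar>\<delta>' i j\<bar> \<le> u \<and>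
      S $$ (i,j) = (A $$ (i,j) - \<sigma> * B $$ (i,j) * (1 + \<delta> i j)) * (1 + \<delta>' i j)"
    using fl unfolding is_fl_shift_def dims by blast
  have "norm2 (S - M) \<le> sqrt (real n) * sqrt (real n) * (u * norm2 M + u * (1 + u) * norm2 (\<sigma> \<cdot>\<^sub>m B))"
  proof (rule norm2_entry_bound)
    show "S - M \<in> carrier_mat n n"
      using M by (simp add: minus_carrier_mat)
    show "0 \<le> u * norm2 M + u * (1 + u) * norm2 (\<sigma> \<cdot>\<^sub>m B)"
      using u by simp
    fix i j assume ij: "i < n" "j < n"
    \<comment> \<open>The subtraction error acts on the entry of \<open>M\<close> and also on the
      already rounded product. The second effect produces the factor \<open>1 + u\<close>, which
      only matters to second order.\<close>
    have "(S - M) $$ (i,j) = M $$ (i,j) * \<delta>' i j - (\<sigma> \<cdot>\<^sub>m B) $$ (i,j) * (\<delta> i j * (1 + \<delta>' i j))"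
      using \<delta>[OF ij] ij A B M S by (simp add: M_def algebra_simps)
    then have "\<bar>(S - M) $$ (i,j)\<bar>
        \<le> \<bar>M $$ (i,j)\<bar> * \<bar>\<delta>' i j\<bar> + \<bar>(\<sigma> \<cdot>\<^sub>m B) $$ (i,j)\<bar> * (\<bar>\<delta> i j\<bar> * \<bar>1 + \<delta>' i j\<bar>)"
      by (metis abs_mult abs_triangle_ineq4)
    also have "\<dots> \<le> norm2 M * u + norm2 (\<sigma> \<cdot>\<^sub>m B) * (u * (1 + u))"
      using \<delta>[OF ij] u ij
      by (intro add_mono mult_mono abs_entry_le_norm2[OF M] abs_entry_le_norm2[OF sB]) auto
    finally show "\<bar>(S - M) $$ (i,j)\<bar> \<le> u * norm2 M + u * (1 + u) * norm2 (\<sigma> \<cdot>\<^sub>m B)"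
      by (simp add: algebra_simps)
  qed
  then show ?thesis
    by (simp add: M_def algebra_simps)
qed

text \<open>Reassociating \<open>C * D * C\<^sup>T * N\<close> exhibits
  \<open>D * C\<^sup>T * N\<close> as a right inverse of the square matrix \<open>C\<close>, hence
  also a left inverse; invertibility of \<open>C\<close> is thus a consequence. Multiplying by
  \<open>D\<close>, which is its own inverse, gives the second claim.\<close>

lemma inverse_of_signature_factorization:
  fixes C :: "real mat"
  assumes C: "C \<in> carrier_mat n n" and D: "D \<in> carrier_mat n n" and N: "N \<in> carrier_mat n n"
    and DD: "D * D = 1\<^sub>m n" and inv: "C * D * C\<^sup>T * N = 1\<^sub>m n"
  shows "D * C\<^sup>T * N * C = 1\<^sub>m n" and "C\<^sup>T * N * C = D"
proof -
  have [simp]: "C\<^sup>T * N * C \<in> carrier_mat n n" "D * C\<^sup>T * N \<in> carrier_mat n n"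
    using C N D by auto
  have "C * (D * C\<^sup>T * N) = 1\<^sub>m n"
    using inv C D N by (simp add: assoc_mult_mat[of _ n n _ n _ n])
  then show left: "D * C\<^sup>T * N * C = 1\<^sub>m n"
    by (intro mat_mult_left_right_inverse[OF C]) auto
  have "C\<^sup>T * N * C = (D * D) * (C\<^sup>T * N * C)"
    by (simp add: DD left_mult_one_mat[of _ n n])
  also have "\<dots> = D * (D * C\<^sup>T * N * C)"
    using C D N by (simp add: assoc_mult_mat[of _ n n _ n _ n])
  finally show "C\<^sup>T * N * C = D"
    using left D by simp
qed

text \<open>\<open>G\<close> is the exact defect of \<open>\<Theta>\<close> in the basis given by
  \<open>V\<close>. Since \<open>V\<close> is orthogonal, \<open>G\<close> equals
  \<open>V\<^sup>T * (Y - V * \<Theta> * V\<^sup>T) * V\<close>, and conjugation by \<open>V\<close>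
  does not increase the norm.\<close>

lemma orthogonal_conjugation:
  assumes V: "V \<in> carrier_mat r r" "V\<^sup>T * V = 1\<^sub>m r"
    and Y: "Y \<in> carrier_mat r r" and \<Theta>: "\<Theta> \<in> carrier_mat r r"
  defines "G \<equiv> V\<^sup>T * Y * V - \<Theta>"
  shows "V * (\<Theta> + G) * V\<^sup>T = Y" and "norm2 G \<le> norm2 (Y - V * \<Theta> * V\<^sup>T)"
proof -
  have Vt: "V\<^sup>T \<in> carrier_mat r r" using V by simp
  have VV: "V * V\<^sup>T = 1\<^sub>m r"
    by (rule mat_mult_left_right_inverse[OF Vt V(1) V(2)])
  have "\<Theta> + G = V\<^sup>T * Y * V"
    using V Y \<Theta> by (intro eq_matI) (auto simp: G_def)
  then have "V * (\<Theta> + G) * V\<^sup>T = (V * V\<^sup>T) * Y * (V * V\<^sup>T)"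
    using V Y by (simp add: assoc_mult_mat[of _ r r _ r _ r])
  then show "V * (\<Theta> + G) * V\<^sup>T = Y"
    using Y by (simp add: VV)
  have VTV: "V * \<Theta> * V\<^sup>T \<in> carrier_mat r r" using V \<Theta> by simp
  have "V\<^sup>T * (V * \<Theta> * V\<^sup>T) * V = (V\<^sup>T * V) * \<Theta> * (V\<^sup>T * V)"
    using V(1) \<Theta> by (simp add: assoc_mult_mat[of _ r r _ r _ r])
  also have "\<dots> = \<Theta>"
    using \<Theta> by (simp add: V(2))
  finally have *: "V\<^sup>T * (V * \<Theta> * V\<^sup>T) * V = \<Theta>" .
  have "V\<^sup>T * (Y - V * \<Theta> * V\<^sup>T) * V = V\<^sup>T * Y * V - V\<^sup>T * (V * \<Theta> * V\<^sup>T) * V"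
    using V Y Vt VTV mult_minus_distrib_mat[OF Vt Y VTV]
      minus_mult_distrib_mat[of "V\<^sup>T * Y" r r "V\<^sup>T * (V * \<Theta> * V\<^sup>T)" V r] by simp
  then have "G = V\<^sup>T * (Y - V * \<Theta> * V\<^sup>T) * V"
    by (simp add: G_def *)
  then have "norm2 G \<le> norm2 (Y - V * \<Theta> * V\<^sup>T) * (norm2 V)\<^sup>2"
    using norm2_congruence_le[OF minus_carrier_mat[OF VTV, of Y] V(1)] by simp
  also have "\<dots> \<le> norm2 (Y - V * \<Theta> * V\<^sup>T) * 1"
    using norm2_isometry_le_1[OF V] by (intro mult_left_mono) (simp_all add: abs_square_le_1)
  finally show "norm2 G \<le> norm2 (Y - V * \<Theta> * V\<^sup>T)"
    by simp
qed

subsection \<open>First-order estimates\<close>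

text \<open>The square of the right-hand side exceeds \<open>m + t\<close> by \<open>t\<close> plus
  a square. The slope is twice the Taylor slope, which is harmless because the term ends up only in
  second-order constants.\<close>

lemma sqrt_add_le_first_order:
  fixes m t :: real
  assumes "0 < m" "0 \<le> t"
  shows "sqrt (m + t) \<le> sqrt m + t / sqrt m"
proof (rule real_le_lsqrt)
  have "m + t \<le> m + 2 * t + (t / sqrt m)\<^sup>2"
    using assms by simp
  also have "\<dots> = (sqrt m + t / sqrt m)\<^sup>2"
    using assms by (simp add: power2_sum)
  finally show "m + t \<le> (sqrt m + t / sqrt m)\<^sup>2" .
qed (use assms in auto)

text \<open>To be applied with \<open>x\<close> the norm of \<open>C\<^sub>b\<close> and
  \<open>\<epsilon> = u * c_n\<close>. It rests on \<open>1 + \<epsilon>\<close> being at most its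
  own square.\<close>

lemma le_sqrt_mult_first_order:
  fixes x \<beta> \<epsilon> :: real
  assumes "x\<^sup>2 \<le> \<beta> * (1 + \<epsilon>)" "0 \<le> \<beta>" "0 \<le> \<epsilon>"
  shows "x \<le> sqrt \<beta> * (1 + \<epsilon>)"
proof (rule power2_le_imp_le)
  have "1 + \<epsilon> \<le> (1 + \<epsilon>)\<^sup>2"
    using assms by (simp add: power2_sum)
  then have "\<beta> * (1 + \<epsilon>) \<le> \<beta> * (1 + \<epsilon>)\<^sup>2"
    using assms by (intro mult_left_mono)
  with assms show "x\<^sup>2 \<le> (sqrt \<beta> * (1 + \<epsilon>))\<^sup>2"
    by (simp add: power_mult_distrib)
qed (use assms in simp)

text \<open>The matching lower bound, in additive form so that it also covers
  \<open>\<epsilon> > 1\<close>, where the term \<open>\<epsilon> * sqrt \<beta>\<close> alone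
  dominates. For \<open>\<epsilon>\<close> up to 1 it holds because \<open>1 - \<epsilon>\<close> is
  at least its own square.\<close>

lemma sqrt_le_first_order:
  fixes x \<beta> \<epsilon> :: real
  assumes "\<beta> * (1 - \<epsilon>) \<le> x\<^sup>2" "0 \<le> \<beta>" "0 \<le> \<epsilon>" "0 \<le> x"
  shows "sqrt \<beta> \<le> x + \<epsilon> * sqrt \<beta>"
proof (cases "\<epsilon> \<le> 1")
  case True
  have "sqrt \<beta> * (1 - \<epsilon>) \<le> x"
  proof (rule power2_le_imp_le)
    have "(1 - \<epsilon>)\<^sup>2 \<le> 1 - \<epsilon>"
      using True assms mult_right_mono[of "1 - \<epsilon>" 1 "1 - \<epsilon>"] by (simp add: power2_eq_square)
    then have "\<beta> * (1 - \<epsilon>)\<^sup>2 \<le> \<beta> * (1 - \<epsilon>)"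
      using assms by (intro mult_left_mono)
    with assms show "(sqrt \<beta> * (1 - \<epsilon>))\<^sup>2 \<le> x\<^sup>2"
      by (simp add: power_mult_distrib)
  qed (use assms in simp)
  then show ?thesis
    by (simp add: algebra_simps)
next
  case False
  then have "1 * sqrt \<beta> \<le> \<epsilon> * sqrt \<beta>"
    using assms by (intro mult_right_mono) auto
  with assms show ?thesis by simp
qed

text \<open>Here \<open>S\<close> is the computed shifted matrix, \<open>V\<close> the orthogonal
  matrix near \<open>U\<close>, and \<open>E'\<close> the perturbation of
  \<open>A - \<sigma>B\<close>. \<open>K\<close> and \<open>u\<^sub>0\<close> are chosen before
  \<open>u\<close>, \<open>r\<close> and all computed matrices, which expresses the uniformity of
  the O(u^2) terms. A two-sided inverse is unique, so the existential over \<open>N\<close> pins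
  down the inverse in the third identity.\<close>

theorem theorem3p1:
  fixes n :: nat
    and A B :: "real mat"
    and \<sigma> \<eta> \<sigma>\<^sub>0 :: real
    and a_n b_n c_n d_n e_n f_n g_n :: real
  assumes A: "A \<in> carrier_mat n n" "A\<^sup>T = A" "A \<noteq> 0\<^sub>m n n"
    and B: "B \<in> carrier_mat n n" "B\<^sup>T = B" "B \<noteq> 0\<^sub>m n n" "positive_semidefinite B"
    and nonsingular: "invertible_mat (A - \<sigma> \<cdot>\<^sub>m B)"
    and pos: "a_n > 0" "b_n > 0" "c_n > 0" "d_n > 0" "e_n > 0" "f_n > 0" "g_n > 0"
    and eta: "\<eta> = sqrt (norm2 (A - \<sigma> \<cdot>\<^sub>m B)) / sqrt (norm2 B)"
    and sigma0: "\<sigma>\<^sub>0 = \<sigma> * norm2 B / norm2 A"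
  shows "\<exists>K > 0. \<exists>u\<^sub>0 > 0. \<forall>u r S C\<^sub>a D\<^sub>a C\<^sub>b X W U V \<Theta>.
    0 < u \<and> u \<le> u\<^sub>0 \<and> r \<le> n \<and>
    is_fl_shift u A B \<sigma> S \<and>
    C\<^sub>a \<in> carrier_mat n n \<and>
    D\<^sub>a \<in> carrier_mat n n \<and> diagonal_mat D\<^sub>a \<and> (\<forall>i<n. D\<^sub>a $$ (i,i) = 1 \<or> D\<^sub>a $$ (i,i) = -1) \<and>
    C\<^sub>b \<in> carrier_mat n r \<and> X \<in> carrier_mat n r \<and> W \<in> carrier_mat r r \<and> U \<in> carrier_mat r r \<and>
    \<Theta> \<in> carrier_mat r r \<and> diagonal_mat \<Theta> \<and>
    V \<in> carrier_mat r r \<and> V\<^sup>T * V = 1\<^sub>m r \<and>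
    norm2 (S - C\<^sub>a * D\<^sub>a * C\<^sub>a\<^sup>T) \<le> u * a_n * norm2 S \<and>
    norm2 C\<^sub>a \<le> b_n * sqrt (norm2 S) \<and>
    norm2 (B - C\<^sub>b * C\<^sub>b\<^sup>T) \<le> u * c_n * norm2 B \<and>
    norm2 (C\<^sub>a * X - C\<^sub>b) \<le> u * d_n * norm2 C\<^sub>a * norm2 X \<and>
    norm2 (W - X\<^sup>T * D\<^sub>a * X) \<le> u * e_n * (norm2 X)^2 \<and>
    W = W\<^sup>T \<and>
    norm2 (W - V * \<Theta> * V\<^sup>T) \<le> u * f_n * norm2 W \<and>
    norm2 (V - U) \<le> u * g_n
    \<longrightarrow>
    (\<exists>F\<^sub>1 \<in> carrier_mat n r. \<exists>E' \<in> carrier_mat n n. \<exists>E \<in> carrier_mat n n.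
     \<exists>F \<in> carrier_mat n n. \<exists>G \<in> carrier_mat r r.
      E'\<^sup>T = E' \<and> E\<^sup>T = E \<and> F\<^sup>T = F \<and> G\<^sup>T = G \<and>
      (C\<^sub>b + F\<^sub>1) * (C\<^sub>b + F\<^sub>1)\<^sup>T = B + F \<and>
      (A + E) - \<sigma> \<cdot>\<^sub>m (B + F) = A - \<sigma> \<cdot>\<^sub>m B + E' \<and>
      A - \<sigma> \<cdot>\<^sub>m B + E' = C\<^sub>a * D\<^sub>a * C\<^sub>a\<^sup>T \<and>
      (\<exists>N \<in> carrier_mat n n.
         inverts_mat (A + E - \<sigma> \<cdot>\<^sub>m (B + F)) N \<and> inverts_mat N (A + E - \<sigma> \<cdot>\<^sub>m (B + F)) \<and>
         (C\<^sub>b + F\<^sub>1)\<^sup>T * N * (C\<^sub>b + F\<^sub>1) = V * (\<Theta> + G) * V\<^sup>T) \<and>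
      norm2 F\<^sub>1 \<le> u * b_n * d_n * \<eta> * norm2 X * norm2 C\<^sub>b + K * u^2 \<and>
      norm2 F \<le> u * (c_n + 2 * b_n * d_n * \<eta> * norm2 X) * norm2 B + K * u^2 \<and>
      norm2 E' \<le> real n * u * norm2 (\<sigma> \<cdot>\<^sub>m B)
                 + u * (real n + a_n) * norm2 (A - \<sigma> \<cdot>\<^sub>m B) + K * u^2 \<and>
      norm2 E \<le> u * (real n * (1 + 2 * \<bar>\<sigma>\<^sub>0\<bar>) + (1 + \<bar>\<sigma>\<^sub>0\<bar>) * a_n + \<bar>\<sigma>\<^sub>0\<bar> * c_n
                      + 2 * \<bar>\<sigma>\<^sub>0\<bar> * b_n * d_n * \<eta> * norm2 X) * norm2 A + K * u^2 \<and>
      norm2 G \<le> u * (e_n + f_n) * (norm2 X)^2 + K * u^2)"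
proof -

  \<comment> \<open>Norms of the data and the uniform constants\<close>
  define M where "M = A - \<sigma> \<cdot>\<^sub>m B"
  define m where "m = norm2 M"
  define s where "s = norm2 (\<sigma> \<cdot>\<^sub>m B)"
  define \<beta> where "\<beta> = norm2 B"
  have M: "M \<in> carrier_mat n n" "M\<^sup>T = M" and sB: "\<sigma> \<cdot>\<^sub>m B \<in> carrier_mat n n"
    using A B by (auto simp: M_def transpose_minus[of _ n n] transpose_smult)
  \<comment> \<open>\<open>invertible_mat\<close> supplies an inverse of unspecified shape; its
    dimensions are read off from the two identities.\<close>
  obtain P where P: "P \<in> carrier_mat n n" "P * M = 1\<^sub>m n"
  proof -
    from nonsingular obtain P where inv: "inverts_mat M P" "inverts_mat P M"
      by (auto simp: invertible_mat_def M_def)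
    have MP: "M * P = 1\<^sub>m n" and PM: "P * M = 1\<^sub>m (dim_row P)"
      using inv M by (simp_all add: inverts_mat_def)
    have "dim_col P = n"
      using arg_cong[OF MP, of dim_col] by simp
    moreover have "dim_row P = n"
      using arg_cong[OF PM, of dim_col] M by simp
    ultimately show ?thesis
      using that[of P] PM by auto
  qed
  define p where "p = norm2 P"
  have n: "n > 0"
    using A by (cases n) auto
  have m: "m > 0"
    unfolding m_def
  proof (rule norm2_pos[OF M(1)])
    show "M \<noteq> 0\<^sub>m n n"
    proof
      assume "M = 0\<^sub>m n n"
      then have "1\<^sub>m n $$ (0,0) = (0\<^sub>m n n :: real mat) $$ (0,0)"
        using P by simp
      then show False using n by simp
    qed
  qed
  have \<beta>: "\<beta> > 0" and normA: "norm2 A > 0"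
    using A B norm2_pos[of B n n] norm2_pos[of A n n] by (auto simp: \<beta>_def)
  have nonneg: "0 \<le> s" "0 \<le> p"
    by (simp_all add: s_def p_def)
  have \<eta>: "sqrt m = \<eta> * sqrt \<beta>" "\<eta> \<ge> 0"
    using \<beta> by (simp_all add: eta m_def \<beta>_def M_def)

  \<comment> \<open>For \<open>u\<close> at most 1, \<open>L1 * u\<close> will bound the rounding
    error of \<open>S\<close>, \<open>L2 * u\<close> the norm of \<open>E'\<close>, and
    \<open>L3 * u\<close> the excess of \<open>sqrt (norm2 S)\<close> over \<open>sqrt m\<close>.
    Then \<open>\<alpha>\<close>, \<open>\<gamma>\<close> and \<open>\<xi>\<close> bound the norms
    of \<open>C\<^sub>a\<close>, \<open>C\<^sub>b\<close> and \<open>X\<close>.\<close>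
  define L1 where "L1 = real n * m + 2 * real n * s"
  define L2 where "L2 = a_n * (m + L1) + L1"
  define L3 where "L3 = L1 / sqrt m"
  define \<alpha> where "\<alpha> = b_n * (sqrt m + L3)"
  define \<gamma> where "\<gamma> = sqrt \<beta> * (1 + c_n)"
  define \<xi> where "\<xi> = 4 * p * \<alpha> * \<gamma>"
  \<comment> \<open>\<open>K1\<close> to \<open>K5\<close> are the coefficients of
    \<open>u\<^sup>2\<close> in the bounds for \<open>E'\<close>, \<open>F\<^sub>1\<close>,
    \<open>F\<close>, \<open>E\<close> and \<open>G\<close>, in this order; \<open>K3'\<close>
    belongs to the product of the norms of \<open>C\<^sub>b\<close> and \<open>F\<^sub>1\<close>.
    The norm of \<open>X\<close> enters them only through its bound \<open>\<xi>\<close>.\<close>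
  define K1 where "K1 = a_n * L1 + real n * s"
  define K2 where "K2 = d_n * b_n * \<xi> * (\<eta> * c_n * sqrt \<beta> + L3)"
  define K3' where "K3' = d_n * b_n * \<xi> * (sqrt m * c_n * sqrt \<beta> + L3 * \<gamma>)"
  define K3 where "K3 = 2 * K3' + (d_n * \<alpha> * \<xi>)\<^sup>2"
  define K4 where "K4 = K1 + \<bar>\<sigma>\<bar> * K3"
  define K5 where "K5 = e_n * f_n * \<xi>\<^sup>2"
  define K where "K = 1 + K1 + K2 + K3 + K4 + K5"
  \<comment> \<open>One reciprocal enforces three smallness conditions: \<open>u\<close> at most 1
    for the crude bounds, \<open>p * L2 * u\<close> at most 1/2 for the inversion of
    \<open>T\<close>, and \<open>4 * p * \<alpha>\<^sup>2 * d_n * u\<close> at most 1 for the bound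
    on \<open>X\<close>.\<close>
  define u\<^sub>0 where "u\<^sub>0 = 1 / (1 + 2 * p * L2 + 4 * p * \<alpha>\<^sup>2 * d_n)"
  have L: "0 \<le> L1" "0 \<le> L2" "0 \<le> L3"
    using m nonneg pos by (auto simp: L1_def L2_def L3_def)
  have \<alpha>: "0 \<le> \<alpha>" and \<gamma>: "0 \<le> \<gamma>"
    using m \<beta> L pos by (auto simp: \<alpha>_def \<gamma>_def)
  have \<xi>: "0 \<le> \<xi>"
    using \<alpha> \<gamma> nonneg by (auto simp: \<xi>_def)
  have K': "0 \<le> K1" "0 \<le> K2" "0 \<le> K3'" "0 \<le> K3" "0 \<le> K5"
    using m \<beta> L \<alpha> \<gamma> \<xi> \<eta> nonneg pos by (simp_all add: K1_def K2_def K3'_def K3_def K5_def)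
  have K4: "0 \<le> K4"
    unfolding K4_def using K' by (intro add_nonneg_nonneg mult_nonneg_nonneg) auto
  have Kpos: "0 < K"
    unfolding K_def using K' K4 by (intro add_pos_nonneg) auto
  have denom: "1 + 2 * p * L2 + 4 * p * \<alpha>\<^sup>2 * d_n > 0"
    using nonneg L \<alpha> pos by (intro add_pos_nonneg) auto
  then have u0pos: "0 < u\<^sub>0"
    by (simp add: u\<^sub>0_def)

  show ?thesis
  proof (rule exI[of _ K], rule conjI[OF Kpos], rule exI[of _ u\<^sub>0], rule conjI[OF u0pos],
      intro allI impI, goal_cases)
    case (1 u r S C\<^sub>a D\<^sub>a C\<^sub>b X W U V \<Theta>)
    then have u: "0 < u" "u \<le> u\<^sub>0" and fl: "is_fl_shift u A B \<sigma> S"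
      and Ca: "C\<^sub>a \<in> carrier_mat n n"
      and Da: "D\<^sub>a \<in> carrier_mat n n" "diagonal_mat D\<^sub>a"
        "\<forall>i<n. D\<^sub>a $$ (i,i) = 1 \<or> D\<^sub>a $$ (i,i) = -1"
      and Cb: "C\<^sub>b \<in> carrier_mat n r" and X: "X \<in> carrier_mat n r" and W: "W \<in> carrier_mat r r"
      and \<Theta>: "\<Theta> \<in> carrier_mat r r" "diagonal_mat \<Theta>"
      and V: "V \<in> carrier_mat r r" "V\<^sup>T * V = 1\<^sub>m r"
      and factA: "norm2 (S - C\<^sub>a * D\<^sub>a * C\<^sub>a\<^sup>T) \<le> u * a_n * norm2 S"
      and normCa: "norm2 C\<^sub>a \<le> b_n * sqrt (norm2 S)"
      and factB: "norm2 (B - C\<^sub>b * C\<^sub>b\<^sup>T) \<le> u * c_n * norm2 B"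
      and solve: "norm2 (C\<^sub>a * X - C\<^sub>b) \<le> u * d_n * norm2 C\<^sub>a * norm2 X"
      and formW: "norm2 (W - X\<^sup>T * D\<^sub>a * X) \<le> u * e_n * (norm2 X)^2"
      and eigW: "norm2 (W - V * \<Theta> * V\<^sup>T) \<le> u * f_n * norm2 W"
      by simp_all

    have "u * (1 + 2 * p * L2 + 4 * p * \<alpha>\<^sup>2 * d_n) \<le> 1"
      using u denom by (simp add: u\<^sub>0_def pos_le_divide_eq)
    moreover have "0 \<le> u * (2 * p * L2)" "0 \<le> u * (4 * p * \<alpha>\<^sup>2 * d_n)"
      using u nonneg L pos by auto
    ultimately have u1: "u \<le> 1" "u * (2 * p * L2) \<le> 1" "u * (4 * p * \<alpha>\<^sup>2 * d_n) \<le> 1"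
      using u unfolding distrib_left mult_1_right by linarith+

    \<comment> \<open>Rounding error of the shift and size of \<open>C\<^sub>a\<close>\<close>
    have S: "S \<in> carrier_mat n n"
      using fl A by (auto simp: is_fl_shift_def)
    \<comment> \<open>\<open>SM\<close> retains the sharp first-order coefficients for the final
      estimate of \<open>E'\<close>; the cruder \<open>SM'\<close> below feeds the
      constants.\<close>
    have SM: "norm2 (S - M) \<le> real n * u * m + real n * u * (1 + u) * s"
      using norm2_fl_shift_error[OF A(1) B(1) _ fl] u by (simp add: M_def m_def s_def)
    also have "\<dots> \<le> real n * u * m + real n * u * 2 * s"
      using u u1 nonneg by (intro add_left_mono mult_right_mono mult_left_mono) auto
    also have "\<dots> = L1 * u"
      by (simp add: L1_def algebra_simps)
    finally have SM': "norm2 (S - M) \<le> L1 * u" .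
    have normS: "norm2 S \<le> m + L1 * u"
      using norm2_le_add_diff[OF S M(1)] SM' by (simp add: m_def)
    then have "sqrt (norm2 S) \<le> sqrt (m + L1 * u)"
      by simp
    also have "\<dots> \<le> sqrt m + L3 * u"
      using sqrt_add_le_first_order[of m "L1 * u"] m L u by (simp add: L3_def)
    finally have sqrtS: "sqrt (norm2 S) \<le> sqrt m + L3 * u" .
    have Ca_le: "norm2 C\<^sub>a \<le> b_n * (sqrt m + L3 * u)"
      using order_trans[OF normCa mult_left_mono[OF sqrtS]] pos by simp
    also have "\<dots> \<le> \<alpha>"
      unfolding \<alpha>_def using pos L u u1 by (intro mult_left_mono add_left_mono mult_left_le) auto
    finally have Ca_le_\<alpha>: "norm2 C\<^sub>a \<le> \<alpha>" .

    \<comment> \<open>The perturbed shifted matrix and its inverse\<close>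
    define T where "T = C\<^sub>a * D\<^sub>a * C\<^sub>a\<^sup>T"
    define E' where "E' = T - M"
    have T: "T \<in> carrier_mat n n" "T\<^sup>T = T"
      using symmetric_congruence[OF Da(1) transpose_diagonal[OF Da(1,2)] Ca] Ca Da
      by (simp_all add: T_def)
    have E'c: "E' \<in> carrier_mat n n" and E't: "E'\<^sup>T = E'"
      using M T by (simp_all add: E'_def minus_carrier_mat transpose_minus[of _ n n])
    have ME': "M + E' = T"
      using M T by (intro eq_matI) (auto simp: E'_def)
    have E'_split: "norm2 E' \<le> u * a_n * norm2 S + norm2 (S - M)"
      using norm2_triangle_diff[OF T(1) S M(1)] norm2_diff_commute_le[OF T(1) S] factA
      by (simp add: E'_def T_def)
    also have "\<dots> \<le> u * a_n * (m + L1 * u) + norm2 (S - M)"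
      using normS u pos by (intro add_right_mono mult_left_mono) auto
    finally have E'_le: "norm2 E' \<le> u * a_n * (m + L1 * u) + norm2 (S - M)" .
    \<comment> \<open>The second-order part is \<open>a_n * L1\<close>, from replacing
      \<open>norm2 S\<close> by \<open>m\<close>, plus \<open>n * s\<close>, from the factor
      \<open>1 + u\<close> in \<open>SM\<close>.\<close>
    then have E'_K1: "norm2 E' \<le> real n * u * s + u * (real n + a_n) * m + K1 * u\<^sup>2"
      using SM by (simp add: K1_def algebra_simps power2_eq_square)
    have "u * a_n * (m + L1 * u) \<le> u * a_n * (m + L1)"
      using u u1 L pos by (intro mult_left_mono add_left_mono mult_left_le) auto
    with E'_le SM' have E'_L2: "norm2 E' \<le> L2 * u"
      by (simp add: L2_def algebra_simps)

    have "p * norm2 E' \<le> p * (L2 * u)"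
      using E'_L2 nonneg by (intro mult_left_mono)
    also have "\<dots> \<le> 1/2"
      using u1 by (simp add: algebra_simps)
    finally obtain N where N: "N \<in> carrier_mat n n" "T * N = 1\<^sub>m n" "N * T = 1\<^sub>m n"
      "norm2 N \<le> 2 * p"
      using obtain_inverse_of_perturbation[OF M(1) P(1) E'c P(2)] unfolding ME' p_def by blast
    have DD: "D\<^sub>a * D\<^sub>a = 1\<^sub>m n"
      by (rule signature_mat_square[OF Da])
    \<comment> \<open>A symmetric matrix whose square is the identity is orthogonal.\<close>
    have Da_le: "norm2 D\<^sub>a \<le> 1"
      using norm2_isometry_le_1[OF Da(1)] transpose_diagonal[OF Da(1,2)] DD by simp
    note inv_Ca = inverse_of_signature_factorization[OF Ca Da(1) N(1) DD N(2)[unfolded T_def]]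

    \<comment> \<open>The perturbation of \<open>C\<^sub>b\<close> and a priori bounds on
      \<open>C\<^sub>b\<close> and \<open>X\<close>\<close>
    define F\<^sub>1 where "F\<^sub>1 = C\<^sub>a * X - C\<^sub>b"
    have CaX: "C\<^sub>a * X \<in> carrier_mat n r"
      using Ca X by simp
    have F1c: "F\<^sub>1 \<in> carrier_mat n r"
      using Cb by (simp add: F\<^sub>1_def minus_carrier_mat)
    have CbF1: "C\<^sub>b + F\<^sub>1 = C\<^sub>a * X"
      using carrier_matD[OF Ca] carrier_matD[OF X] carrier_matD[OF Cb]
      by (intro eq_matI) (auto simp: F\<^sub>1_def)
    define x where "x = norm2 X"
    define cb where "cb = norm2 C\<^sub>b"
    define f1 where "f1 = norm2 F\<^sub>1"
    have xcf: "0 \<le> x" "0 \<le> cb" "0 \<le> f1"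
      by (simp_all add: x_def cb_def f1_def)

    have CbCb: "C\<^sub>b * C\<^sub>b\<^sup>T \<in> carrier_mat n n"
      using Cb by simp
    have factB': "norm2 (C\<^sub>b * C\<^sub>b\<^sup>T - B) \<le> u * c_n * \<beta>"
      using order_trans[OF norm2_diff_commute_le[OF CbCb B(1)] factB] by (simp add: \<beta>_def)
    have "cb\<^sup>2 \<le> \<beta> * (1 + u * c_n)"
      using norm2_le_add_diff[OF CbCb B(1)] factB'
      by (simp add: norm2_mult_transpose cb_def \<beta>_def algebra_simps)
    then have cb_le: "cb \<le> sqrt \<beta> * (1 + u * c_n)"
      using u pos \<beta> by (intro le_sqrt_mult_first_order) auto
    also have "\<dots> \<le> \<gamma>"
      unfolding \<gamma>_def using u1 \<beta> pos u by (intro mult_left_mono add_left_mono mult_left_le_one_le) auto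
    finally have cb_le_\<gamma>: "cb \<le> \<gamma>" .
    have "\<beta> * (1 - u * c_n) \<le> cb\<^sup>2"
      using norm2_le_add_diff[OF B(1) CbCb] factB
      by (simp add: norm2_mult_transpose cb_def \<beta>_def algebra_simps)
    then have cb_ge: "sqrt \<beta> \<le> cb + u * c_n * sqrt \<beta>"
      using u pos \<beta> xcf by (intro sqrt_le_first_order) auto

    have f1_le_\<alpha>: "f1 \<le> u * d_n * \<alpha> * x"
      unfolding f1_def F\<^sub>1_def x_def using u pos Ca_le_\<alpha>
      by (intro order_trans[OF solve] mult_right_mono mult_left_mono) auto
    \<comment> \<open>The bound on \<open>f1\<close> contains \<open>x\<close> itself, so
      \<open>x\<close> occurs on both sides of the estimate. The third condition in
      \<open>u\<^sub>0\<close> makes its coefficient on the right at most 1/2, and absorbing it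
      doubles \<open>2 * p * \<alpha> * \<gamma>\<close> to \<open>\<xi>\<close>.\<close>
    have x_le: "x \<le> \<xi>"
    proof -
      have "X = (D\<^sub>a * C\<^sub>a\<^sup>T * N * C\<^sub>a) * X"
        using inv_Ca(1) X by simp
      also have "\<dots> = D\<^sub>a * (C\<^sub>a\<^sup>T * (N * (C\<^sub>a * X)))"
        using Ca Da N X by (simp add: assoc_mult_mat[of _ n n _ n _ n] assoc_mult_mat[of _ n n _ n _ r])
      finally have "x = norm2 (D\<^sub>a * (C\<^sub>a\<^sup>T * (N * (C\<^sub>a * X))))"
        by (simp add: x_def)
      also have "\<dots> \<le> norm2 D\<^sub>a * norm2 (C\<^sub>a\<^sup>T * (N * (C\<^sub>a * X)))"
        using Ca Da N X by (intro norm2_mult_le[of _ n n _ r]) auto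
      also have "\<dots> \<le> 1 * norm2 (C\<^sub>a\<^sup>T * (N * (C\<^sub>a * X)))"
        using Da_le by (intro mult_right_mono) auto
      also have "\<dots> \<le> 1 * (norm2 C\<^sub>a\<^sup>T * norm2 (N * (C\<^sub>a * X)))"
        using Ca N X by (intro mult_left_mono norm2_mult_le[of _ n n _ r]) auto
      also have "\<dots> \<le> 1 * (norm2 C\<^sub>a\<^sup>T * (norm2 N * norm2 (C\<^sub>a * X)))"
        using Ca N X by (intro mult_left_mono norm2_mult_le[of _ n n _ r]) auto
      also have "\<dots> \<le> 1 * (\<alpha> * (2 * p * (cb + f1)))"
        using Ca_le_\<alpha> N(4) \<alpha> nonneg xcf norm2_add_le[OF Cb F1c]
        by (intro mult_left_mono mult_mono) (auto simp: norm2_transpose CbF1 cb_def f1_def)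
      also have "\<dots> \<le> 1 * (\<alpha> * (2 * p * (\<gamma> + u * d_n * \<alpha> * x)))"
        using cb_le_\<gamma> f1_le_\<alpha> \<alpha> nonneg by (intro mult_left_mono add_mono) auto
      also have "\<dots> = \<xi> / 2 + (u * (4 * p * \<alpha>\<^sup>2 * d_n)) * (x / 2)"
        by (simp add: \<xi>_def algebra_simps power2_eq_square)
      also have "\<dots> \<le> \<xi> / 2 + 1 * (x / 2)"
        using u1(3) xcf by (intro add_left_mono mult_right_mono) auto
      finally show ?thesis by simp
    qed

    \<comment> \<open>\<open>t\<close> is the factor of order \<open>u\<close> shared by the
      estimates of \<open>f1\<close> and \<open>cb * f1\<close>. It is kept exact in first-order
      terms and replaced by its bound with \<open>\<xi>\<close> in second-order ones.\<close>
    define t where "t = u * (d_n * b_n * x)"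
    have t0: "0 \<le> t"
      using u pos xcf by (simp add: t_def)
    have t_le: "t \<le> u * (d_n * b_n * \<xi>)"
      unfolding t_def using u pos x_le by (intro mult_left_mono) auto
    have "f1 \<le> u * d_n * (b_n * (sqrt m + L3 * u)) * x"
      unfolding f1_def F\<^sub>1_def x_def using u pos Ca_le
      by (intro order_trans[OF solve] mult_right_mono mult_left_mono) auto
    then have f1_le_t: "f1 \<le> t * (sqrt m + L3 * u)"
      by (simp add: t_def algebra_simps)
    have f1_le: "f1 \<le> u * b_n * d_n * \<eta> * x * cb + K2 * u\<^sup>2"
    proof -
      \<comment> \<open>The claimed bound involves the norm of \<open>C\<^sub>b\<close> rather than
        \<open>sqrt \<beta>\<close>, so the lower estimate \<open>cb_ge\<close> is the one to
        use.\<close>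
      have "sqrt m \<le> \<eta> * (cb + u * c_n * sqrt \<beta>)"
        using mult_left_mono[OF cb_ge \<eta>(2)] by (simp add: \<eta>(1))
      then have "t * (sqrt m + L3 * u) \<le> t * (\<eta> * (cb + u * c_n * sqrt \<beta>) + L3 * u)"
        using t0 by (intro mult_left_mono) auto
      also have "\<dots> = t * (\<eta> * cb) + t * (u * (\<eta> * c_n * sqrt \<beta> + L3))"
        by (simp add: algebra_simps)
      also have "t * (u * (\<eta> * c_n * sqrt \<beta> + L3))
          \<le> u * (d_n * b_n * \<xi>) * (u * (\<eta> * c_n * sqrt \<beta> + L3))"
        using t_le u pos \<eta> \<beta> L by (intro mult_right_mono) auto
      finally show ?thesis
        using f1_le_t by (simp add: t_def K2_def algebra_simps power2_eq_square)
    qed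

    \<comment> \<open>The perturbation of \<open>B\<close>\<close>
    define F where "F = (C\<^sub>a * X) * (C\<^sub>a * X)\<^sup>T - B"
    have CaX2: "(C\<^sub>a * X) * (C\<^sub>a * X)\<^sup>T \<in> carrier_mat n n"
      using CaX by simp
    have CaX2t: "((C\<^sub>a * X) * (C\<^sub>a * X)\<^sup>T)\<^sup>T = (C\<^sub>a * X) * (C\<^sub>a * X)\<^sup>T"
      using CaX transpose_mult[of "C\<^sub>a * X" n r "(C\<^sub>a * X)\<^sup>T" n] by simp
    have Fc: "F \<in> carrier_mat n n" and Ft: "F\<^sup>T = F"
      using CaX2 CaX2t B transpose_minus[OF CaX2 B(1)] by (simp_all add: F_def minus_carrier_mat)
    have BF: "(C\<^sub>b + F\<^sub>1) * (C\<^sub>b + F\<^sub>1)\<^sup>T = B + F"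
      unfolding CbF1 using CaX2 B by (intro eq_matI) (auto simp: F_def)
    have cbf1: "cb * f1 \<le> u * b_n * d_n * \<eta> * x * \<beta> + K3' * u\<^sup>2"
    proof -
      have "cb * f1 \<le> (sqrt \<beta> * (1 + u * c_n)) * (t * (sqrt m + L3 * u))"
        using cb_le f1_le_t xcf u pos \<beta> by (intro mult_mono) auto
      also have "\<dots> = t * (sqrt m * sqrt \<beta>)
          + t * (u * (sqrt m * c_n * sqrt \<beta> + L3 * (sqrt \<beta> * (1 + u * c_n))))"
        by (simp add: algebra_simps)
      also have "sqrt m * sqrt \<beta> = \<eta> * \<beta>"
        using \<beta> by (simp add: \<eta>(1))
      also have "t * (u * (sqrt m * c_n * sqrt \<beta> + L3 * (sqrt \<beta> * (1 + u * c_n))))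
          \<le> u * (d_n * b_n * \<xi>) * (u * (sqrt m * c_n * sqrt \<beta> + L3 * \<gamma>))"
        unfolding \<gamma>_def using t_le t0 u u1 pos L \<beta> m \<xi>
        by (intro mult_mono mult_left_mono add_left_mono mult_left_le_one_le) auto
      finally show ?thesis
        by (simp add: t_def K3'_def algebra_simps power2_eq_square)
    qed
    have F_le: "norm2 F \<le> u * (c_n + 2 * b_n * d_n * \<eta> * x) * \<beta> + K3 * u\<^sup>2"
    proof -
      \<comment> \<open>The factorization error contributes \<open>c_n\<close>, the two cross terms
        contribute the factor 2, and the square of \<open>F\<^sub>1\<close> is of second order by
        the a priori bound on \<open>X\<close>.\<close>
      have "(C\<^sub>b + F\<^sub>1) * (C\<^sub>b + F\<^sub>1)\<^sup>T = C\<^sub>b * C\<^sub>b\<^sup>T + F\<^sub>1 * C\<^sub>b\<^sup>T + (C\<^sub>b * F\<^sub>1\<^sup>T + F\<^sub>1 * F\<^sub>1\<^sup>T)"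
        using Cb F1c
        by (simp add: transpose_add[of _ n r] add_mult_distrib_mat[of _ n r _ _ n]
            mult_add_distrib_mat[of _ n r _ n])
      then have "F = (C\<^sub>b * C\<^sub>b\<^sup>T - B) + (F\<^sub>1 * C\<^sub>b\<^sup>T + (C\<^sub>b * F\<^sub>1\<^sup>T + F\<^sub>1 * F\<^sub>1\<^sup>T))"
        unfolding F_def CbF1[symmetric] using Cb F1c B
        by (intro eq_matI) auto
      moreover have c: "C\<^sub>b * C\<^sub>b\<^sup>T - B \<in> carrier_mat n n" "F\<^sub>1 * C\<^sub>b\<^sup>T \<in> carrier_mat n n"
        "C\<^sub>b * F\<^sub>1\<^sup>T \<in> carrier_mat n n" "F\<^sub>1 * F\<^sub>1\<^sup>T \<in> carrier_mat n n"
        using Cb F1c B by (auto simp: minus_carrier_mat)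
      ultimately have "norm2 F \<le> norm2 (C\<^sub>b * C\<^sub>b\<^sup>T - B)
          + (norm2 (F\<^sub>1 * C\<^sub>b\<^sup>T) + (norm2 (C\<^sub>b * F\<^sub>1\<^sup>T) + norm2 (F\<^sub>1 * F\<^sub>1\<^sup>T)))"
        by (auto intro!: order_trans[OF norm2_add_le[of _ n n]] add_left_mono)
      also have "\<dots> \<le> u * c_n * \<beta> + (f1 * cb + (cb * f1 + f1\<^sup>2))"
        using factB' norm2_mult_le[of F\<^sub>1 n r "C\<^sub>b\<^sup>T" n] norm2_mult_le[of C\<^sub>b n r "F\<^sub>1\<^sup>T" n] Cb F1c
        by (intro add_mono) (simp_all add: f1_def cb_def norm2_transpose norm2_mult_transpose)
      also have "f1\<^sup>2 \<le> (u * d_n * \<alpha> * \<xi>)\<^sup>2"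
        using x_le xcf u pos \<alpha>
        by (intro power_mono order_trans[OF f1_le_\<alpha>] mult_left_mono) auto
      finally show ?thesis
        using cbf1 by (simp add: K3_def algebra_simps power_mult_distrib)
    qed

    \<comment> \<open>The perturbation of \<open>A\<close>\<close>
    define E where "E = E' + \<sigma> \<cdot>\<^sub>m F"
    have Ec: "E \<in> carrier_mat n n" and Et: "E\<^sup>T = E"
      using E'c E't Fc Ft by (simp_all add: E_def transpose_add[of _ n n] transpose_smult)
    \<comment> \<open>This identity forces \<open>E\<close> once \<open>E'\<close> and
      \<open>F\<close> are known.\<close>
    have AE: "(A + E) - \<sigma> \<cdot>\<^sub>m (B + F) = A - \<sigma> \<cdot>\<^sub>m B + E'"
      using A B E'c Fc by (intro eq_matI) (auto simp: E_def algebra_simps)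
    have AT: "A - \<sigma> \<cdot>\<^sub>m B + E' = C\<^sub>a * D\<^sub>a * C\<^sub>a\<^sup>T"
      using ME' by (simp add: M_def T_def)
    have shift: "\<bar>\<sigma>\<bar> * \<beta> = \<bar>\<sigma>\<^sub>0\<bar> * norm2 A"
      using normA by (simp add: sigma0 \<beta>_def abs_mult)
    have s_le: "s \<le> \<bar>\<sigma>\<^sub>0\<bar> * norm2 A"
      using norm2_smult_le[OF B(1), of \<sigma>] shift by (simp add: s_def \<beta>_def)
    have m_le: "m \<le> (1 + \<bar>\<sigma>\<^sub>0\<bar>) * norm2 A"
      using norm2_diff_le[OF A(1) sB] s_le by (simp add: m_def M_def s_def algebra_simps)
    \<comment> \<open>All norms are now measured against \<open>norm2 A\<close>. The terms of
      \<open>E'\<close> in \<open>s\<close> and in \<open>m\<close> contribute \<open>n\<close>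
      times \<open>\<bar>\<sigma>\<^sub>0\<bar>\<close> and
      \<open>1 + \<bar>\<sigma>\<^sub>0\<bar>\<close>, which add up to
      \<open>n * (1 + 2 * \<bar>\<sigma>\<^sub>0\<bar>)\<close>.\<close>
    have E_le: "norm2 E \<le> u * (real n * (1 + 2 * \<bar>\<sigma>\<^sub>0\<bar>) + (1 + \<bar>\<sigma>\<^sub>0\<bar>) * a_n + \<bar>\<sigma>\<^sub>0\<bar> * c_n
                      + 2 * \<bar>\<sigma>\<^sub>0\<bar> * b_n * d_n * \<eta> * x) * norm2 A + K4 * u\<^sup>2"
    proof -
      have "norm2 E \<le> norm2 E' + \<bar>\<sigma>\<bar> * norm2 F"
        unfolding E_def using E'c Fc norm2_smult_le[OF Fc, of \<sigma>] norm2_add_le[OF E'c, of "\<sigma> \<cdot>\<^sub>m F"]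
        by simp
      also have "\<dots> \<le> (real n * u * (\<bar>\<sigma>\<^sub>0\<bar> * norm2 A)
            + u * (real n + a_n) * ((1 + \<bar>\<sigma>\<^sub>0\<bar>) * norm2 A) + K1 * u\<^sup>2)
          + \<bar>\<sigma>\<bar> * (u * (c_n + 2 * b_n * d_n * \<eta> * x) * \<beta> + K3 * u\<^sup>2)"
        using s_le m_le u pos K'
        by (intro add_mono mult_left_mono F_le order_trans[OF E'_K1]) auto
      also have "\<dots> = real n * u * (\<bar>\<sigma>\<^sub>0\<bar> * norm2 A)
            + u * (real n + a_n) * ((1 + \<bar>\<sigma>\<^sub>0\<bar>) * norm2 A)
          + u * (c_n + 2 * b_n * d_n * \<eta> * x) * (\<bar>\<sigma>\<bar> * \<beta>) + K4 * u\<^sup>2"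
        by (simp add: K4_def algebra_simps)
      finally show ?thesis
        unfolding shift by (simp add: algebra_simps)
    qed

    \<comment> \<open>The perturbation of the eigenvalue matrix\<close>
    define Y where "Y = X\<^sup>T * D\<^sub>a * X"
    define G where "G = V\<^sup>T * Y * V - \<Theta>"
    have Y: "Y \<in> carrier_mat r r" "Y\<^sup>T = Y"
      using symmetric_congruence[OF Da(1) transpose_diagonal[OF Da(1,2)], of "X\<^sup>T" r] X Da
      by (simp_all add: Y_def)
    have VYV: "V\<^sup>T * Y * V \<in> carrier_mat r r" "(V\<^sup>T * Y * V)\<^sup>T = V\<^sup>T * Y * V"
      using symmetric_congruence[OF Y, of "V\<^sup>T" r] V Y by simp_all
    have Gc: "G \<in> carrier_mat r r" and Gt: "G\<^sup>T = G"
      using VYV \<Theta> transpose_diagonal[OF \<Theta>]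
      by (simp_all add: G_def minus_carrier_mat transpose_minus[of _ r r])
    have Neq: "(C\<^sub>b + F\<^sub>1)\<^sup>T * N * (C\<^sub>b + F\<^sub>1) = V * (\<Theta> + G) * V\<^sup>T"
    proof -
      have "(C\<^sub>a * X)\<^sup>T * N * (C\<^sub>a * X) = X\<^sup>T * (C\<^sub>a\<^sup>T * N * C\<^sub>a) * X"
        using Ca X N
        by (simp add: transpose_mult[of _ n n _ r] assoc_mult_mat[of _ n n _ n _ n]
            assoc_mult_mat[of _ n n _ n _ r] assoc_mult_mat[of _ r n _ n _ n]
            assoc_mult_mat[of _ r n _ n _ r])
      also have "\<dots> = Y"
        by (simp only: inv_Ca(2) Y_def)
      finally show ?thesis
        using orthogonal_conjugation(1)[OF V Y(1) \<Theta>(1)] by (simp add: CbF1 G_def)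
    qed
    have inv1: "inverts_mat (A + E - \<sigma> \<cdot>\<^sub>m (B + F)) N"
      and inv2: "inverts_mat N (A + E - \<sigma> \<cdot>\<^sub>m (B + F))"
      unfolding AE AT T_def[symmetric] using N T by (auto simp: inverts_mat_def)
    have normY: "norm2 Y \<le> x\<^sup>2"
    proof -
      have "norm2 Y \<le> norm2 D\<^sub>a * x\<^sup>2"
        unfolding Y_def x_def by (rule norm2_congruence_le[OF Da(1) X])
      also have "\<dots> \<le> 1 * x\<^sup>2"
        by (intro mult_right_mono Da_le) simp
      finally show ?thesis by simp
    qed
    \<comment> \<open>The distance from \<open>Y\<close> to \<open>V * \<Theta> * V\<^sup>T\<close>
      is split at \<open>W\<close>. The eigenvalue error is relative to the norm of
      \<open>W\<close>, which is at most \<open>(1 + u * e_n) * x\<^sup>2\<close>; hence the product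
      \<open>e_n * f_n\<close> in \<open>K5\<close>.\<close>
    have G_le: "norm2 G \<le> u * (e_n + f_n) * x\<^sup>2 + K5 * u\<^sup>2"
    proof -
      have VTV: "V * \<Theta> * V\<^sup>T \<in> carrier_mat r r"
        using V \<Theta> by simp
      have YW: "norm2 (W - Y) \<le> u * e_n * x\<^sup>2"
        using formW by (simp add: Y_def x_def)
      then have "norm2 W \<le> x\<^sup>2 + u * e_n * x\<^sup>2"
        using norm2_le_add_diff[OF W Y(1)] normY by simp
      then have "u * f_n * norm2 W \<le> u * f_n * (x\<^sup>2 + u * e_n * x\<^sup>2)"
        using u pos by (intro mult_left_mono) auto
      then have "norm2 G \<le> u * e_n * x\<^sup>2 + u * f_n * (x\<^sup>2 + u * e_n * x\<^sup>2)"
        using orthogonal_conjugation(2)[OF V Y(1) \<Theta>(1)] norm2_triangle_diff[OF Y(1) W VTV]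
          norm2_diff_commute_le[OF Y(1) W] YW eigW unfolding G_def by linarith
      also have "\<dots> = u * (e_n + f_n) * x\<^sup>2 + e_n * f_n * x\<^sup>2 * u\<^sup>2"
        by (simp add: algebra_simps power2_eq_square)
      also have "\<dots> \<le> u * (e_n + f_n) * x\<^sup>2 + K5 * u\<^sup>2"
        unfolding K5_def using pos x_le xcf
        by (intro add_left_mono mult_right_mono mult_left_mono power_mono) auto
      finally show ?thesis .
    qed

    \<comment> \<open>Assembly of the bounds under the common constant\<close>
    have "K1 * u\<^sup>2 \<le> K * u\<^sup>2" "K2 * u\<^sup>2 \<le> K * u\<^sup>2" "K3 * u\<^sup>2 \<le> K * u\<^sup>2"
      "K4 * u\<^sup>2 \<le> K * u\<^sup>2" "K5 * u\<^sup>2 \<le> K * u\<^sup>2"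
      using K' K4 by (auto intro!: mult_right_mono simp: K_def)
    then have
      "norm2 F\<^sub>1 \<le> u * b_n * d_n * \<eta> * norm2 X * norm2 C\<^sub>b + K * u^2"
      "norm2 F \<le> u * (c_n + 2 * b_n * d_n * \<eta> * norm2 X) * norm2 B + K * u^2"
      "norm2 E' \<le> real n * u * norm2 (\<sigma> \<cdot>\<^sub>m B)
                 + u * (real n + a_n) * norm2 (A - \<sigma> \<cdot>\<^sub>m B) + K * u^2"
      "norm2 E \<le> u * (real n * (1 + 2 * \<bar>\<sigma>\<^sub>0\<bar>) + (1 + \<bar>\<sigma>\<^sub>0\<bar>) * a_n + \<bar>\<sigma>\<^sub>0\<bar> * c_n
                      + 2 * \<bar>\<sigma>\<^sub>0\<bar> * b_n * d_n * \<eta> * norm2 X) * norm2 A + K * u^2"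
      "norm2 G \<le> u * (e_n + f_n) * (norm2 X)^2 + K * u^2"
      using f1_le F_le E'_K1 E_le G_le
      unfolding f1_def x_def cb_def \<beta>_def s_def m_def M_def by linarith+
    note bounds = this
    show ?case
      by (rule bexI[OF _ F1c], rule bexI[OF _ E'c], rule bexI[OF _ Ec], rule bexI[OF _ Fc],
          rule bexI[OF _ Gc], intro conjI bexI[OF _ N(1)])
        (fact E't Et Ft Gt BF AE AT inv1 inv2 Neq bounds)+
  qed
qed

end
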